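(* Let $p\in[0,1]$ and $d\in\mathbb N$, and let $(G_t)_{t\ge0}$ be the growing directed graph generated by the linear growth copying model with parameters $p,d$ (defined in the context). Then there is a constant $C$, not depending on $n$, such that asymptotically almost surely (as $n\to\infty$) the diameter of $G_n$ is at most $4e\log n + C$.
   Context: Conventions: $\mathbb N=\{1,2,\dots\}$; $\log$ is the natural logarithm and $e$ its base; $[d]=\{1,\dots,d\}$. Graphs are finite and may have loops and parallel edges. Distance between two vertices of a directed graph is the number of edges in a shortest path ignoring edge directions; the diameter is the maximum distance between two vertices. The initial graph $G_0$ is finite of size $O(1)$ (bounded independently of $n$). "Asymptotically almost surely" means with probability tending to $1$ as $n\to\infty$. All random choices at time $t$ have the stated distributions conditionally on the history of the process up to time $t-1$. Linear growth copying model: every vertex has out-degree $d$, and the $d$ outgoing edges of each vertex carry a fixed ordering. $G_0$ is an arbitrary weakly connected directed graph with all vertices having out-degree $d$. In each time-step $t\in\mathbb N$ a new vertex $v$ is born and $d$ outgoing edges from $v$ to vertices of $G_{t-1}$ are added as follows. An ambassador vertex $W$ is sampled uniformly from the vertices of $G_{t-1}$. For each $i\in[d]$, the head of the $i$-th outgoing edge of $v$ is chosen as follows: with probability $p$ it is a vertex of $G_{t-1}$ sampled uniformly, and with probability $1-p$ it is the head of the $i$-th outgoing edge of $W$. The choice of $W$, the choices of which of the two alternatives is used for each $i$, and the uniform samples are independent. *)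

theory Defs
  imports
    "HOL-Probability.Probability"
    "Graph_Theory.Digraph_Component"
    "Graph_Theory.Shortest_Path"
begin

text \<open>
  A directed multigraph (loops and parallel arcs allowed) in which every vertex has out-degree d
  and the outgoing arcs of every vertex are ordered. The arc (u, i), with i in {1..d}, is the i-th
  outgoing arc of u; its head is an arbitrary vertex.
\<close>

type_synonym ordered_digraph = "(nat, nat \<times> nat) pre_digraph"

definition d_out_digraph :: "nat \<Rightarrow> ordered_digraph \<Rightarrow> bool" where
  "d_out_digraph d G \<longleftrightarrow> fin_digraph G \<and> arcs G = verts G \<times> {1..d} \<and> tail G = fst"

text \<open>
  The qualified name is needed since \<open>connected\<close> is also a topological notion. It is weak
  connectivity (reachability in the symmetric closure) and includes that the graph has a vertex.
\<close>

definition initial_graph :: "nat \<Rightarrow> ordered_digraph \<Rightarrow> bool" where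
  "initial_graph d G \<longleftrightarrow> d_out_digraph d G \<and> Digraph_Component.connected G"

text \<open>
  \<open>mk_symmetric\<close> merges parallel arcs, which does not affect distances; with unit weights
  \<open>\<mu>\<close> is the least number of arcs of a walk, and infinite if there is none.
\<close>

definition undirected_dist :: "('a, 'b) pre_digraph \<Rightarrow> 'a \<Rightarrow> 'a \<Rightarrow> ereal" where
  "undirected_dist G u v = wf_digraph.\<mu> (with_proj (mk_symmetric G)) (\<lambda>_. 1) u v"

definition graph_diameter :: "('a, 'b) pre_digraph \<Rightarrow> ereal" where
  "graph_diameter G = (SUP u\<in>verts G. SUP v\<in>verts G. undirected_dist G u v)"

definition fresh_vertex :: "ordered_digraph \<Rightarrow> nat" where
  "fresh_vertex G = Suc (Max (verts G))"

definition add_out_vertex :: "nat \<Rightarrow> (nat \<Rightarrow> nat) \<Rightarrow> ordered_digraph \<Rightarrow> ordered_digraph" where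
  "add_out_vertex d h G =
     (let v = fresh_vertex G in
      \<lparr> verts = insert v (verts G),
        arcs = arcs G \<union> {v} \<times> {1..d},
        tail = fst,
        head = (\<lambda>(u, i). if u = v then h i else head G (u, i)) \<rparr>)"

text \<open>
  W is the ambassador; B i tells whether the i-th head is uniform (probability p) or copied from
  the ambassador; U i is the uniform candidate for the i-th head. All of these are independent.
  The second argument of \<open>Pi_pmf\<close> is the irrelevant value taken outside {1..d}.
\<close>

definition copying_step :: "nat \<Rightarrow> real \<Rightarrow> ordered_digraph \<Rightarrow> ordered_digraph pmf" where
  "copying_step d p G =
     do {
       W \<leftarrow> pmf_of_set (verts G);
       B \<leftarrow> Pi_pmf {1..d} False (\<lambda>_. bernoulli_pmf p);
       U \<leftarrow> Pi_pmf {1..d} 0 (\<lambda>_. pmf_of_set (verts G));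
       return_pmf (add_out_vertex d (\<lambda>i. if B i then U i else head G (W, i)) G)
     }"

text \<open>The distribution of the graph after t steps, started from G0.\<close>

primrec copying_graph :: "nat \<Rightarrow> real \<Rightarrow> ordered_digraph \<Rightarrow> nat \<Rightarrow> ordered_digraph pmf" where
  "copying_graph d p G0 0 = return_pmf G0"
| "copying_graph d p G0 (Suc t) = copying_graph d p G0 t \<bind> copying_step d p"

end

theory Submission
  imports Defs "HOL-Real_Asymp.Real_Asymp"
begin

text \<open>
  The new vertex is within distance 2 of a uniformly random older vertex, so its distance from G0
  is at most 2 more than that of a uniform vertex, as in a random recursive tree with edges of
  length 2. If \<open>a\<^sub>k(t)\<close> is the expected number of vertices at distance more than \<open>2k\<close> from G0,
  then \<open>a\<^sub>k\<^sub>+\<^sub>1(t+1) \<le> a\<^sub>k\<^sub>+\<^sub>1(t) + a\<^sub>k(t)/(t+1)\<close>, and the tail of the exponential series satisfies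
  the opposite inequality at the harmonic numbers; so \<open>a\<^sub>k(t)\<close> is at most the sum of \<open>h^j/j!\<close> over
  \<open>j > k\<close>, with h the t-th harmonic number. For k about \<open>e (1 + ln t)\<close> this is of the order of
  \<open>(k/e)^k/k!\<close>, which tends to 0, and Markov's inequality bounds the eccentricity from G0 by \<open>2k\<close>.
  The decay of \<open>(k/e)^k/k!\<close> (like \<open>k^(-1/2)\<close>) is what allows an additive constant: an exponential
  moment bound would only make the failure probability smaller than a positive constant.
\<close>

section \<open>Tails of the exponential series\<close>

text \<open>This is \<open>exp x\<close> minus its Taylor polynomial of degree below
  \<open>k\<close>. The first exponent is \<open>k\<close> itself, so a sum over exponents larger
  than \<open>k\<close> appears as \<open>exp_tail (Suc k)\<close>.\<close>

definition exp_tail :: "nat \<Rightarrow> real \<Rightarrow> real" where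
  "exp_tail k x = (\<Sum>j. x ^ (j + k) / fact (j + k))"

lemma summable_exp_tail: "summable (\<lambda>j. x ^ (j + k) / fact (j + k) :: real)"
proof -
  have "summable (\<lambda>j. x ^ j / fact j)"
    using summable_exp_generic[of x] by (simp add: divide_inverse mult.commute)
  then show ?thesis
    by (rule summable_ignore_initial_segment)
qed

lemma exp_tail_nonneg: "0 \<le> x \<Longrightarrow> 0 \<le> exp_tail k x"
  unfolding exp_tail_def by (intro suminf_nonneg summable_exp_tail) simp

lemma exp_tail_1: "exp_tail 1 x = exp x - 1"
proof -
  have "exp x = (\<Sum>j. x ^ j / fact j)"
    by (simp add: exp_def divide_inverse mult.commute)
  then show ?thesis
    using suminf_split_head[OF summable_exp_tail[of x 0, simplified]]
    by (simp add: exp_tail_def)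
qed

text \<open>These are the first two terms of the binomial expansion, and the others are nonnegative.
  Multiplying by \<open>x + h\<close> in the induction discards only
  \<open>(n + 1) * h^2 * x^n\<close>.\<close>

lemma power_Suc_add_ge:
  fixes x h :: real
  assumes "0 \<le> x" "0 \<le> h"
  shows "x ^ Suc n + real (Suc n) * h * x ^ n \<le> (x + h) ^ Suc n"
proof (induction n)
  case (Suc n)
  have "x ^ Suc (Suc n) + real (Suc (Suc n)) * h * x ^ Suc n
      \<le> (x ^ Suc n + real (Suc n) * h * x ^ n) * (x + h)"
    using assms by (simp add: algebra_simps)
  also have "\<dots> \<le> (x + h) ^ Suc n * (x + h)"
    using Suc assms by (intro mult_right_mono) auto
  finally show ?case by (simp add: mult.commute)
qed simp

text \<open>The derivative of \<open>exp_tail (Suc k)\<close> is \<open>exp_tail k\<close>, so this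
  is the tangent inequality for a function convex on the nonnegative reals. It is proved term by
  term, which avoids differentiation.\<close>

lemma exp_tail_add_ge:
  assumes "0 \<le> x" "0 \<le> h"
  shows "exp_tail (Suc k) x + h * exp_tail k x \<le> exp_tail (Suc k) (x + h)"
proof -
  have "exp_tail (Suc k) x + h * exp_tail k x
      = (\<Sum>j. x ^ (j + Suc k) / fact (j + Suc k) + h * (x ^ (j + k) / fact (j + k)))"
    unfolding exp_tail_def
    by (simp only: suminf_mult[OF summable_exp_tail, symmetric]
          suminf_add[OF summable_exp_tail summable_mult[OF summable_exp_tail]])
  also have "\<dots> \<le> exp_tail (Suc k) (x + h)"
    unfolding exp_tail_def
  proof (intro suminf_le summable_add summable_mult summable_exp_tail)
    fix j
    have "x ^ (j + Suc k) / fact (j + Suc k) + h * (x ^ (j + k) / fact (j + k))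
        = (x ^ Suc (j + k) + real (Suc (j + k)) * h * x ^ (j + k)) / fact (Suc (j + k))"
      by (simp add: field_simps del: of_nat_Suc)
    also have "\<dots> \<le> (x + h) ^ Suc (j + k) / fact (Suc (j + k))"
      by (intro divide_right_mono power_Suc_add_ge assms) simp
    finally show "x ^ (j + Suc k) / fact (j + Suc k) + h * (x ^ (j + k) / fact (j + k))
        \<le> (x + h) ^ (j + Suc k) / fact (j + Suc k)"
      by simp
  qed
  finally show ?thesis .
qed

text \<open>Consecutive terms have ratio \<open>x / (j + k + 1)\<close>, which is at most 1/2, so a
  geometric series with the same first term dominates.\<close>

lemma exp_tail_le:
  assumes "0 \<le> x" "2 * x \<le> real k + 1"
  shows "exp_tail k x \<le> 2 * (x ^ k / fact k)"
proof -
  have term_le: "x ^ (j + k) / fact (j + k) \<le> x ^ k / fact k * (1 / 2) ^ j" for j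
  proof (induction j)
    case (Suc j)
    have "x ^ (Suc j + k) / fact (Suc j + k)
        = (x ^ (j + k) / fact (j + k)) * (x / real (Suc (j + k)))"
      by (simp add: mult.commute)
    also have "\<dots> \<le> (x ^ k / fact k * (1 / 2) ^ j) * (1 / 2)"
      using Suc assms by (intro mult_mono) (auto simp: field_simps)
    finally show ?case by simp
  qed simp
  have "exp_tail k x \<le> (\<Sum>j. x ^ k / fact k * (1 / 2) ^ j)"
    unfolding exp_tail_def
    by (intro suminf_le term_le summable_exp_tail summable_mult summable_geometric) simp
  also have "\<dots> = 2 * (x ^ k / fact k)"
    by (subst suminf_mult) (auto simp: suminf_geometric)
  finally show ?thesis .
qed

section \<open>Decay of the Poisson probability at its mean\<close>

text \<open>The term is the probability that a Poisson variable of mean \<open>k\<close> equals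
  \<open>k\<close>. Instead of Stirling's formula, successive ratios are used:
  \<open>s (k + 1) / s k\<close> is \<open>(1 + 1/k)^k / e\<close>, about \<open>1 - 1/(2k)\<close>.
  Multiplying by a power of \<open>k\<close> with exponent below 1/2, here 1/4, still leaves an
  eventually decreasing sequence \<open>r\<close>. Hence \<open>r\<close> is bounded and
  \<open>s k\<close> is O(\<open>k powr (-1/4)\<close>).\<close>

lemma poisson_mode_tendsto_0: "(\<lambda>k. (real k / exp 1) ^ k / fact k) \<longlonglongrightarrow> 0"
proof -
  define s where "s k = (real k / exp 1) ^ k / fact k" for k :: nat
  define r where "r k = s k * real k powr (1 / 4)" for k :: nat
  have Suc_eq: "real (Suc k) = real k * (1 + 1 / real k)" if "k > 0" for k
    using that by (simp add: field_simps)
  have s_Suc: "s (Suc k) = s k * ((1 + 1 / real k) ^ k / exp 1)" if "k > 0" for k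
  proof -
    have pow: "real (Suc k) ^ k = real k ^ k * (1 + 1 / real k) ^ k"
      by (simp only: Suc_eq[OF that] power_mult_distrib)
    have "s (Suc k) = real (Suc k) ^ k / (exp 1 * exp 1 ^ k * fact k)"
      unfolding s_def power_divide power_Suc fact_Suc by (simp del: of_nat_Suc)
    also have "\<dots> = s k * ((1 + 1 / real k) ^ k / exp 1)"
      unfolding pow s_def power_divide by simp
    finally show ?thesis .
  qed
  \<comment> \<open>The left side divided by \<open>e\<close> is \<open>1 - 1/(4k)\<close> up to
    O(\<open>1/k^2\<close>).\<close>
  have "eventually (\<lambda>k::nat. (1 + 1 / real k) ^ k * (1 + 1 / real k) powr (1 / 4) \<le> exp 1) sequentially"
    by real_asymp
  then obtain N where N: "\<And>k. k \<ge> N \<Longrightarrow> (1 + 1 / real k) ^ k * (1 + 1 / real k) powr (1 / 4) \<le> exp 1"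
    unfolding eventually_sequentially by blast
  have s_nonneg: "0 \<le> s k" for k by (simp add: s_def)
  have r_Suc: "r (Suc k) \<le> r k" if "k \<ge> Suc N" for k
  proof -
    have "k > 0" using that by simp
    then have "r (Suc k) = r k * (((1 + 1 / real k) ^ k * (1 + 1 / real k) powr (1 / 4)) / exp 1)"
      by (simp only: r_def s_Suc Suc_eq powr_mult) simp
    also have "\<dots> \<le> r k * 1"
      using N[of k] that s_nonneg by (intro mult_left_mono) (auto simp: r_def)
    finally show ?thesis by simp
  qed
  have r_le: "r k \<le> r (Suc N)" if "k \<ge> Suc N" for k
    using that
  proof (induction k rule: dec_induct)
    case (step k)
    then show ?case using r_Suc[of k] by simp
  qed simp
  have "s \<longlonglongrightarrow> 0"
  proof (rule tendsto_sandwich)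
    show "eventually (\<lambda>k. 0 \<le> s k) sequentially" by (simp add: s_nonneg)
    show "eventually (\<lambda>k. s k \<le> r (Suc N) * real k powr - (1 / 4)) sequentially"
      using eventually_ge_at_top[of "Suc N"]
    proof eventually_elim
      case (elim k)
      then show ?case
        using r_le[of k] by (simp add: r_def powr_minus_divide pos_le_divide_eq)
    qed
    show "(\<lambda>k. r (Suc N) * real k powr - (1 / 4)) \<longlonglongrightarrow> 0" by real_asymp
  qed simp
  then show ?thesis unfolding s_def .
qed

section \<open>Harmonic numbers and the logarithm\<close>

text \<open>The difference of the harmonic number and the logarithm decreases and equals 1 at
  1.\<close>

lemma harm_le_ln:
  assumes "n > 0"
  shows "(harm n :: real) \<le> 1 + ln (real n)"
proof -
  obtain m where m: "n = Suc m" using assms by (cases n) auto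
  show ?thesis
    using decseqD[OF decseq_harm_diff_ln, of 0 m] by (simp add: m harm_expand)
qed

lemma exp_harm_ge: "real n + 1 \<le> exp (harm n)"
  using ln_le_harm[of n] exp_le_cancel_iff[of "ln (real n + 1)" "harm n"] by simp

section \<open>Bounded distance ignoring directions\<close>

text \<open>The reflexive closure turns walks of exactly \<open>k\<close> edges into walks of at
  most \<open>k\<close> edges, and relation powers make such bounds compose. Every element is
  related to itself, even outside \<open>verts G\<close>; passing to walks therefore takes a start
  in \<open>verts G\<close>.\<close>

definition near :: "('a, 'b) pre_digraph \<Rightarrow> nat \<Rightarrow> ('a \<times> 'a) set" where
  "near G k = ((parcs (mk_symmetric G))\<^sup>=) ^^ k"

lemma near_trans: "(u, v) \<in> near G j \<Longrightarrow> (v, w) \<in> near G k \<Longrightarrow> (u, w) \<in> near G (j + k)"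
  unfolding near_def relpow_add by (rule relcompI)

lemma near_refl: "(u, u) \<in> near G k"
  unfolding near_def
proof (induction k)
  case (Suc k)
  then show ?case by (rule relpow_Suc_I) simp
qed simp

lemma near_sym:
  assumes "(u, v) \<in> near G k"
  shows "(v, u) \<in> near G k"
proof -
  let ?E = "(parcs (mk_symmetric G))\<^sup>="
  have E: "(x, y) \<in> ?E \<longleftrightarrow> (y, x) \<in> ?E" for x y by (auto simp: parcs_mk_symmetric)
  have "(v, u) \<in> ?E ^^ k"
    using assms unfolding near_def
  proof (induction k arbitrary: v)
    case (Suc k)
    from Suc.prems obtain w where "(u, w) \<in> ?E ^^ k" "(w, v) \<in> ?E" by (rule relpow_Suc_E)
    from \<open>(w, v) \<in> ?E\<close> have "(v, w) \<in> ?E" by (rule iffD1[OF E])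
    then show ?case using Suc.IH[OF \<open>(u, w) \<in> ?E ^^ k\<close>] by (rule relpow_Suc_I2)
  qed simp
  then show ?thesis by (simp add: near_def)
qed

lemma near_mono:
  assumes "parcs (mk_symmetric G) \<subseteq> parcs (mk_symmetric H)"
  shows "near G k \<subseteq> near H k"
  unfolding near_def
proof (induction k)
  case (Suc k)
  moreover have "(parcs (mk_symmetric G))\<^sup>= \<subseteq> (parcs (mk_symmetric H))\<^sup>="
    using assms by blast
  ultimately show ?case by (simp only: relpow.simps relcomp_mono)
qed simp

lemma near_Suc_0: "(u, v) \<in> parcs (mk_symmetric G) \<Longrightarrow> (u, v) \<in> near G 1"
  by (simp add: near_def)

lemma (in wf_digraph) undirected_dist_le_if_near:
  assumes "(u, v) \<in> near G k" "u \<in> verts G"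
  shows "undirected_dist G u v \<le> ereal (real k)"
proof -
  interpret S: pair_wf_digraph "mk_symmetric G" ..
  have "\<exists>q. S.awalk u q v \<and> length q \<le> k"
    using assms(1) unfolding near_def
  proof (induction k arbitrary: v)
    case 0
    then show ?case using assms(2) by (auto simp: S.awalk_Nil_iff)
  next
    case (Suc k)
    from Suc.prems obtain w where w: "(u, w) \<in> ((parcs (mk_symmetric G))\<^sup>=) ^^ k"
      "(w, v) \<in> (parcs (mk_symmetric G))\<^sup>=" by (rule relpow_Suc_E)
    with Suc.IH obtain q where q: "S.awalk u q w" "length q \<le> k" by blast
    show ?case
    proof (cases "w = v")
      case True
      then show ?thesis using q by (auto intro: le_SucI)
    next
      case False
      then have "(w, v) \<in> parcs (mk_symmetric G)" using w by auto
      then have "S.awalk w [(w, v)] v" by (auto simp: S.awalk_Cons_iff S.awalk_Nil_iff dest: S.in_arcsD2)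
      then have "S.awalk u (q @ [(w, v)]) v" using q by (auto intro: S.awalk_appendI)
      then show ?thesis using q by (intro exI[of _ "q @ [(w, v)]"]) auto
    qed
  qed
  then obtain q where q: "S.awalk u q v" "length q \<le> k" by blast
  have "undirected_dist G u v \<le> ereal (S.awalk_cost (\<lambda>_. 1) q)"
    unfolding undirected_dist_def by (rule S.min_cost_le_walk_cost[OF q(1)])
  also have "\<dots> \<le> ereal (real k)"
    using q(2) by (simp add: S.awalk_cost_def sum_list_triv)
  finally show ?thesis .
qed

text \<open>A simple path has fewer arcs than the graph has vertices. This bounds distances inside
  the initial graph by its size.\<close>

lemma (in fin_digraph) near_if_connected:
  assumes "Digraph_Component.connected G" "u \<in> verts G" "v \<in> verts G" "card (verts G) \<le> k"
  shows "(u, v) \<in> near G k"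
proof -
  interpret S: pair_fin_digraph "mk_symmetric G" ..
  have "u \<rightarrow>\<^sup>*\<^bsub>with_proj (mk_symmetric G)\<^esub> v"
    using assms by (auto simp: Digraph_Component.connected_def strongly_connected_def)
  then obtain q where q: "S.apath u q v"
    using S.reachable_apath by blast
  have len: "length q \<le> k"
    using S.length_apath[OF q] assms(4) by simp
  from q have "S.awalk u q v" by (rule S.awalkI_apath)
  then have "(u, v) \<in> near G (length q)"
  proof (induction q arbitrary: u)
    case Nil
    then show ?case by (simp add: S.awalk_Nil_iff near_refl)
  next
    case (Cons e q)
    obtain x w where e: "e = (x, w)" by fastforce
    have "u = x" "e \<in> parcs (mk_symmetric G)" "S.awalk w q v"
      using Cons.prems by (simp_all add: S.awalk_Cons_iff e)
    then have "(u, w) \<in> near G 1" "(w, v) \<in> near G (length q)"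
      using Cons.IH e by (simp_all add: near_def)
    then show ?case using near_trans[of u w G 1 v "length q"] by simp
  qed
  with len show ?thesis
    using near_trans[OF _ near_refl, of u v G "length q" "k - length q"] by simp
qed

section \<open>Vertices far from the initial graph\<close>

text \<open>Distances are counted in units of two edges, the cost of one generation. The set
  \<open>A\<close> will be the vertex set of the initial graph and stays fixed while
  \<open>G\<close> grows.\<close>

definition far :: "'a set \<Rightarrow> ('a, 'b) pre_digraph \<Rightarrow> nat \<Rightarrow> 'a set" where
  "far A G k = {v \<in> verts G. \<forall>a\<in>A. (a, v) \<notin> near G (2 * k)}"

lemma far_subset_verts: "far A G k \<subseteq> verts G"
  by (auto simp: far_def)

text \<open>Two vertices are joined through vertices \<open>a\<close> and \<open>b\<close> of
  \<open>A\<close> near them, by walks of lengths \<open>2k\<close>, \<open>l\<close> and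
  \<open>2k\<close>.\<close>

lemma (in wf_digraph) graph_diameter_le:
  assumes "far A G k = {}" "A \<subseteq> verts G" "\<And>a b. a \<in> A \<Longrightarrow> b \<in> A \<Longrightarrow> (a, b) \<in> near G l"
  shows "graph_diameter G \<le> ereal (real (4 * k + l))"
  unfolding graph_diameter_def
proof (intro SUP_least undirected_dist_le_if_near)
  fix u v assume "u \<in> verts G" "v \<in> verts G"
  then obtain a b where ab: "a \<in> A" "b \<in> A" "(a, u) \<in> near G (2 * k)" "(b, v) \<in> near G (2 * k)"
    using assms(1) unfolding far_def by blast
  then have "(u, v) \<in> near G (2 * k + l + 2 * k)"
    using near_trans[OF near_trans[OF near_sym[OF ab(3)] assms(3)[OF ab(1,2)]] ab(4)] by simp
  then show "(u, v) \<in> near G (4 * k + l)"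
    by (simp add: algebra_simps)
qed

section \<open>Effect of one added vertex on the graph\<close>

lemma fresh_vertex_notin: "finite (verts G) \<Longrightarrow> fresh_vertex G \<notin> verts G"
  unfolding fresh_vertex_def using Max_ge[of "verts G" "Suc (Max (verts G))"] by (metis Suc_n_not_le_n)

lemma add_out_vertex_simps:
  "verts (add_out_vertex d h G) = insert (fresh_vertex G) (verts G)"
  "arcs (add_out_vertex d h G) = arcs G \<union> {fresh_vertex G} \<times> {1..d}"
  "tail (add_out_vertex d h G) = fst"
  "head (add_out_vertex d h G) (u, i) = (if u = fresh_vertex G then h i else head G (u, i))"
  by (simp_all add: add_out_vertex_def Let_def)

lemma d_out_digraph_head_in_verts:
  assumes "d_out_digraph d G" "u \<in> verts G" "i \<in> {1..d}"
  shows "head G (u, i) \<in> verts G"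
proof -
  interpret fin_digraph G using assms by (simp add: d_out_digraph_def)
  show ?thesis using assms by (intro head_in_verts) (auto simp: d_out_digraph_def)
qed

lemma d_out_digraph_parcs:
  assumes "d_out_digraph d G"
  shows "parcs (mk_symmetric G)
    = (\<Union>u\<in>verts G. \<Union>i\<in>{1..d}. {(u, head G (u, i)), (head G (u, i), u)})"
proof -
  have "arcs G = verts G \<times> {1..d}" "tail G = fst" using assms by (auto simp: d_out_digraph_def)
  moreover have "(\<Union>e\<in>A \<times> B. f e) = (\<Union>u\<in>A. \<Union>i\<in>B. f (u, i))" 
    for A B :: "nat set" and f :: "nat \<times> nat \<Rightarrow> (nat \<times> nat) set"
    by auto
  ultimately show ?thesis by (simp only: parcs_mk_symmetric fst_conv)
qed

lemma d_out_digraph_add_out_vertex: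
  assumes G: "d_out_digraph d G" and h: "\<And>i. i \<in> {1..d} \<Longrightarrow> h i \<in> verts G"
  shows "d_out_digraph d (add_out_vertex d h G)"
proof -
  interpret fin_digraph G using G by (simp add: d_out_digraph_def)
  have arcs: "arcs G = verts G \<times> {1..d}" using G by (simp add: d_out_digraph_def)
  have "fin_digraph (add_out_vertex d h G)"
    by unfold_locales
      (auto simp: add_out_vertex_simps arcs h d_out_digraph_head_in_verts[OF G, simplified])
  then show ?thesis
    by (auto simp: d_out_digraph_def add_out_vertex_simps arcs)
qed

lemma parcs_add_out_vertex:
  assumes G: "d_out_digraph d G" and h: "\<And>i. i \<in> {1..d} \<Longrightarrow> h i \<in> verts G"
  shows "parcs (mk_symmetric (add_out_vertex d h G)) = parcs (mk_symmetric G)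
    \<union> (\<Union>i\<in>{1..d}. {(fresh_vertex G, h i), (h i, fresh_vertex G)})"
proof -
  let ?v = "fresh_vertex G"
  have "finite (verts G)" using G by (auto simp: d_out_digraph_def dest: fin_digraph.finite_verts)
  then have old: "u \<noteq> fresh_vertex G" if "u \<in> verts G" for u
    using that fresh_vertex_notin by blast
  have "(\<Union>u\<in>verts G. \<Union>i\<in>{1..d}. {(u, head (add_out_vertex d h G) (u, i)),
        (head (add_out_vertex d h G) (u, i), u)}) = parcs (mk_symmetric G)"
    unfolding d_out_digraph_parcs[OF G]
    by (intro SUP_cong refl) (simp add: add_out_vertex_simps old)
  moreover have "(\<Union>i\<in>{1..d}. {(?v, head (add_out_vertex d h G) (?v, i)),
        (head (add_out_vertex d h G) (?v, i), ?v)}) = (\<Union>i\<in>{1..d}. {(?v, h i), (h i, ?v)})"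
    by (simp add: add_out_vertex_simps)
  moreover have "parcs (mk_symmetric (add_out_vertex d h G))
      = (\<Union>u\<in>insert ?v (verts G). \<Union>i\<in>{1..d}. {(u, head (add_out_vertex d h G) (u, i)),
          (head (add_out_vertex d h G) (u, i), u)})"
    using d_out_digraph_parcs[OF d_out_digraph_add_out_vertex[of d G h, OF G h]]
    by (simp only: add_out_vertex_simps(1))
  ultimately show ?thesis
    by (simp only: UN_insert Un_commute)
qed

text \<open>
  If the first head is copied from W, then the new vertex and W have a common neighbour. Hence in
  either case the new vertex is at distance at most 2 from a uniformly chosen vertex.
\<close>

lemma far_add_out_vertex:
  fixes B :: "nat \<Rightarrow> bool" and U :: "nat \<Rightarrow> nat"
  assumes G: "d_out_digraph d G" and "d \<ge> 1" and W: "W \<in> verts G"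
    and U: "\<And>i. i \<in> {1..d} \<Longrightarrow> U i \<in> verts G"
  defines "P \<equiv> if B 1 then U 1 else W"
    and "G' \<equiv> add_out_vertex d (\<lambda>i. if B i then U i else head G (W, i)) G"
  shows "far A G' (Suc k) \<subseteq> far A G (Suc k) \<union> (if P \<in> far A G k then {fresh_vertex G} else {})"
proof -
  let ?v = "fresh_vertex G"
  let ?h = "\<lambda>i. if B i then U i else head G (W, i)"
  have one: "1 \<in> {1..d}" using \<open>d \<ge> 1\<close> by simp
  have h: "?h i \<in> verts G" if "i \<in> {1..d}" for i
    using that U d_out_digraph_head_in_verts[OF G W] by simp
  have parcs: "parcs (mk_symmetric G')
      = parcs (mk_symmetric G) \<union> (\<Union>i\<in>{1..d}. {(?v, ?h i), (?h i, ?v)})"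
    unfolding G'_def by (rule parcs_add_out_vertex[of d G ?h, OF G h])
  have mono: "near G j \<subseteq> near G' j" for j
    by (rule near_mono) (simp add: parcs)
  have head_near: "(?h 1, ?v) \<in> near G' 1"
    using one by (intro near_Suc_0) (auto simp: parcs)
  have step: "(P, ?v) \<in> near G' 2"
  proof (cases "B 1")
    case True
    \<comment> \<open>Here the parent is adjacent to the new vertex, and a trivial step pads the
      walk to length 2.\<close>
    have "(?v, ?v) \<in> near G' 1" by (simp add: near_def)
    with head_near True show ?thesis
      using near_trans[of P ?v G' 1 ?v 1] by (simp add: P_def numeral_2_eq_2)
  next
    case False
    have "(W, head G (W, 1)) \<in> parcs (mk_symmetric G')"
      unfolding parcs d_out_digraph_parcs[OF G] using W one by blast
    then show ?thesis
      using head_near False near_trans[of P "?h 1" G' 1 ?v 1] near_Suc_0[of P "?h 1" G']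
      by (simp add: P_def numeral_2_eq_2)
  qed
  have P: "P \<in> verts G" using W U one by (simp add: P_def)
  show ?thesis
  proof
    fix x assume x: "x \<in> far A G' (Suc k)"
    show "x \<in> far A G (Suc k) \<union> (if P \<in> far A G k then {?v} else {})"
    proof (cases "x = ?v")
      case True
      have "P \<in> far A G k"
      \<comment> \<open>Adding arcs only shortens distances, so a parent not far in the old graph is
        not far in the new one, and two more edges reach the new vertex.\<close>
      proof (rule ccontr)
        assume "P \<notin> far A G k"
        then obtain a where "a \<in> A" "(a, P) \<in> near G' (2 * k)"
          using P mono unfolding far_def by blast
        then have "(a, ?v) \<in> near G' (2 * Suc k)"
          using near_trans[OF _ step, of a "2 * k"] by simp
        then show False using x \<open>a \<in> A\<close> True by (auto simp: far_def)
      qed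
      then show ?thesis using True by simp
    next
      case False
      then have "x \<in> verts G" using x by (auto simp: far_def G'_def add_out_vertex_simps)
      then show ?thesis using x mono unfolding far_def by blast
    qed
  qed
qed

section \<open>Expected effect of one random step\<close>

text \<open>Given \<open>B\<close>, the parent is either \<open>U 1\<close> or \<open>W\<close>.
  Both are uniform on \<open>V\<close> and independent of \<open>B\<close>, so the value of
  \<open>p\<close> does not influence the law.\<close>

lemma parent_distribution:
  fixes d :: nat
  assumes "d \<ge> 1" "finite V" "V \<noteq> {}"
  shows "do {
      W \<leftarrow> pmf_of_set V;
      B \<leftarrow> Pi_pmf {1..d} False (\<lambda>_. bernoulli_pmf p);
      U \<leftarrow> Pi_pmf {1..d} x (\<lambda>_. pmf_of_set V);
      return_pmf (if B 1 then U 1 else W)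
    } = pmf_of_set V"
proof -
  let ?U = "Pi_pmf {1..d} x (\<lambda>_. pmf_of_set V)"
  have "map_pmf (\<lambda>U. U 1) ?U = pmf_of_set V"
    using assms by (subst Pi_pmf_component) auto
  then have "bind_pmf (pmf_of_set V) (\<lambda>W. bind_pmf ?U (\<lambda>U. return_pmf (if B 1 then U 1 else W)))
      = pmf_of_set V" for B :: "nat \<Rightarrow> bool"
    by (cases "B 1") (simp_all add: map_pmf_def bind_return_pmf')
  then show ?thesis
    \<comment> \<open>Drawing \<open>B\<close> before \<open>W\<close> amounts to conditioning on
      \<open>B\<close>.\<close>
    by (subst bind_commute_pmf) simp
qed

lemma set_pmf_copying_step:
  assumes G: "d_out_digraph d G" "verts G \<noteq> {}" and "G' \<in> set_pmf (copying_step d p G)"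
  obtains W B U where "W \<in> verts G" "\<And>i. i \<in> {1..d} \<Longrightarrow> U i \<in> verts G"
    "G' = add_out_vertex d (\<lambda>i. if B i then U i else head G (W, i)) G"
proof -
  have fin: "finite (verts G)" using G by (auto simp: d_out_digraph_def dest: fin_digraph.finite_verts)
  from assms(3) obtain W B U where *: "W \<in> verts G"
    "U \<in> set_pmf (Pi_pmf {1..d} 0 (\<lambda>_. pmf_of_set (verts G)))"
    "G' = add_out_vertex d (\<lambda>i. if B i then U i else head G (W, i)) G"
    using fin G(2) by (auto simp: copying_step_def)
  from *(2) have "U i \<in> verts G" if "i \<in> {1..d}" for i
    using that fin G(2) by (auto simp: set_Pi_pmf PiE_dflt_def)
  with * show ?thesis using that by blast
qed

text \<open>At most the new vertex joins the far set, and only if its uniform parent was far one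
  level lower. Integrals in \<open>ennreal\<close> need no integrability conditions.\<close>

lemma nn_integral_far_copying_step:
  assumes G: "d_out_digraph d G" "verts G \<noteq> {}" and "d \<ge> 1"
  shows "(\<integral>\<^sup>+ G'. of_nat (card (far A G' (Suc k))) \<partial>copying_step d p G)
    \<le> of_nat (card (far A G (Suc k))) + of_nat (card (far A G k)) * ennreal (1 / real (card (verts G)))"
proof -
  have fin: "finite (verts G)" using G by (auto simp: d_out_digraph_def dest: fin_digraph.finite_verts)
  then have fin_far: "finite (far A G j)" for j
    using far_subset_verts by (rule rev_finite_subset)
  let ?V = "pmf_of_set (verts G)"
  let ?B = "Pi_pmf {1..d} False (\<lambda>_. bernoulli_pmf p)"
  let ?U = "Pi_pmf {1..d} 0 (\<lambda>_. ?V)"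
  let ?P = "\<lambda>W B U. if B 1 then U 1 else W :: nat"
  let ?c = "of_nat (card (far A G (Suc k))) :: ennreal"
  have card_le: "card (far A (add_out_vertex d (\<lambda>i. if B i then U i else head G (W, i)) G) (Suc k))
      \<le> card (far A G (Suc k)) + (if ?P W B U \<in> far A G k then 1 else 0)"
    if "W \<in> set_pmf ?V" "U \<in> set_pmf ?U" for W B U
  proof -
    have "W \<in> verts G" using that(1) fin G(2) by simp
    moreover have "U i \<in> verts G" if "i \<in> {1..d}" for i
      using \<open>U \<in> set_pmf ?U\<close> that fin G(2) by (auto simp: set_Pi_pmf PiE_dflt_def)
    ultimately have "card (far A (add_out_vertex d (\<lambda>i. if B i then U i else head G (W, i)) G) (Suc k))
      \<le> card (far A G (Suc k) \<union> (if ?P W B U \<in> far A G k then {fresh_vertex G} else {}))"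
      by (intro card_mono far_add_out_vertex G(1) \<open>d \<ge> 1\<close>) (auto simp: fin_far)
    also have "\<dots> \<le> card (far A G (Suc k)) + (if ?P W B U \<in> far A G k then 1 else 0)"
      by (rule order_trans[OF card_Un_le]) simp
    finally show ?thesis .
  qed
  have "(\<integral>\<^sup>+ G'. of_nat (card (far A G' (Suc k))) \<partial>copying_step d p G)
      = (\<integral>\<^sup>+ W. \<integral>\<^sup>+ B. \<integral>\<^sup>+ U. of_nat (card (far A
          (add_out_vertex d (\<lambda>i. if B i then U i else head G (W, i)) G) (Suc k))) \<partial>?U \<partial>?B \<partial>?V)"
    by (simp add: copying_step_def)
  also have "\<dots> \<le> (\<integral>\<^sup>+ W. \<integral>\<^sup>+ B. \<integral>\<^sup>+ U. ?c + indicator (far A G k) (?P W B U) \<partial>?U \<partial>?B \<partial>?V)"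
  proof (intro nn_integral_mono_AE AE_pmfI)
    fix W B U assume "W \<in> set_pmf ?V" "U \<in> set_pmf ?U"
    from card_le[OF this, of B, THEN of_nat_mono[where 'a = ennreal]]
    show "of_nat (card (far A (add_out_vertex d (\<lambda>i. if B i then U i else head G (W, i)) G) (Suc k)))
        \<le> ?c + indicator (far A G k) (?P W B U)"
      by (simp add: indicator_def split: if_splits)
  qed
  also have "\<dots> = ?c + (\<integral>\<^sup>+ W. \<integral>\<^sup>+ B. \<integral>\<^sup>+ U. indicator (far A G k) (?P W B U) \<partial>?U \<partial>?B \<partial>?V)"
    by (simp add: nn_integral_add measure_pmf.emeasure_space_1[simplified])
  \<comment> \<open>The integrand depends on the three samples only through the parent, so the
    triple integral is one over the law of the parent.\<close>
  also have "(\<integral>\<^sup>+ W. \<integral>\<^sup>+ B. \<integral>\<^sup>+ U. indicator (far A G k) (?P W B U) \<partial>?U \<partial>?B \<partial>?V)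
      = (\<integral>\<^sup>+ x. indicator (far A G k) x \<partial>?V)"
    using arg_cong[OF parent_distribution[OF \<open>d \<ge> 1\<close> fin G(2), of p 0],
        of "\<lambda>M. nn_integral (measure_pmf M) (indicator (far A G k))"]
    by simp
  also have "\<dots> = of_nat (card (far A G k)) * ennreal (1 / real (card (verts G)))"
  proof -
    have "verts G \<inter> far A G k = far A G k" by (rule inf_absorb2[OF far_subset_verts])
    then show ?thesis
      using fin G(2) by (simp add: emeasure_pmf_of_set ennreal_of_nat_eq_real_of_nat flip: ennreal_mult)
  qed
  finally show ?thesis .
qed

section \<open>Expected number of far vertices over time\<close>

text \<open>The size controls the probability of each parent, and the inclusion of arcs keeps
  distances within the initial graph from growing.\<close>

lemma copying_graph_invariant:
  assumes "initial_graph d G0" "G \<in> set_pmf (copying_graph d p G0 t)"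
  shows "d_out_digraph d G \<and> verts G0 \<subseteq> verts G \<and> card (verts G) = card (verts G0) + t
    \<and> parcs (mk_symmetric G0) \<subseteq> parcs (mk_symmetric G)"
  using assms(2)
proof (induction t arbitrary: G)
  case 0
  then show ?case using assms(1) by (auto simp: initial_graph_def)
next
  case (Suc t)
  then obtain H where H: "H \<in> set_pmf (copying_graph d p G0 t)" "G \<in> set_pmf (copying_step d p H)"
    by auto
  note IH = Suc.IH[OF H(1)]
  have "verts G0 \<noteq> {}"
    using assms(1) by (auto simp: initial_graph_def Digraph_Component.connected_def strongly_connected_def)
  then have ne: "verts H \<noteq> {}" using IH by blast
  have out: "d_out_digraph d H" using IH by blast
  then have fin: "finite (verts H)" by (auto simp: d_out_digraph_def dest: fin_digraph.finite_verts)
  from set_pmf_copying_step[OF out ne H(2)] obtain W B U where *: "W \<in> verts H"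
    "\<And>i. i \<in> {1..d} \<Longrightarrow> U i \<in> verts H"
    "G = add_out_vertex d (\<lambda>i. if B i then U i else head H (W, i)) H" by blast
  let ?h = "\<lambda>i. if B i then U i else head H (W, i)"
  have h: "?h i \<in> verts H" if "i \<in> {1..d}" for i
    using that * d_out_digraph_head_in_verts[OF out] by simp
  have "d_out_digraph d G"
    unfolding *(3) by (rule d_out_digraph_add_out_vertex[of d H ?h, OF out h])
  moreover have "parcs (mk_symmetric H) \<subseteq> parcs (mk_symmetric G)"
    unfolding *(3) using parcs_add_out_vertex[of d H ?h, OF out h] by simp
  moreover have "card (verts G) = Suc (card (verts H))" "verts H \<subseteq> verts G"
    using fresh_vertex_notin[OF fin] fin by (auto simp: *(3) add_out_vertex_simps)
  ultimately show ?case using IH by auto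
qed

text \<open>Induction on time for all levels at once, since the recursion for level
  \<open>k + 1\<close> calls on level \<open>k\<close> at the previous time.\<close>

lemma nn_integral_card_far_le:
  assumes "initial_graph d G0" "d \<ge> 1"
  shows "(\<integral>\<^sup>+ G. of_nat (card (far (verts G0) G k)) \<partial>copying_graph d p G0 t)
    \<le> ennreal (exp_tail (Suc k) (harm t))"
proof -
  let ?A = "verts G0"
  have ne: "?A \<noteq> {}" and fin: "finite ?A"
    using assms(1) by (auto simp: initial_graph_def Digraph_Component.connected_def
      strongly_connected_def d_out_digraph_def dest: fin_digraph.finite_verts)
  show ?thesis
  proof (induction t arbitrary: k)
    case 0
    have "far ?A G0 k = {}" using near_refl[of _ G0 "2 * k"] unfolding far_def by blast
    then show ?case by simp
  next
    case (Suc t)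
    note IH = Suc.IH
    show ?case
    proof (cases k)
      \<comment> \<open>No lower level exists, so all \<open>t + 1\<close> new vertices are counted.
        Their number is at most \<open>exp (harm (t + 1)) - 1\<close>, which is the tail from
        exponent 1.\<close>
      case 0
      have "(\<integral>\<^sup>+ G. of_nat (card (far ?A G k)) \<partial>copying_graph d p G0 (Suc t))
          \<le> (\<integral>\<^sup>+ G. ennreal (real (Suc t)) \<partial>copying_graph d p G0 (Suc t))"
      proof (intro nn_integral_mono_AE AE_pmfI)
        fix G assume "G \<in> set_pmf (copying_graph d p G0 (Suc t))"
        note inv = copying_graph_invariant[OF assms(1) this]
        then have "finite (verts G)" by (auto simp: d_out_digraph_def dest: fin_digraph.finite_verts)
        moreover have "far ?A G k \<subseteq> verts G - ?A" by (auto simp: 0 far_def near_def)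
        ultimately have "card (far ?A G k) \<le> card (verts G - ?A)" by (intro card_mono) auto
        also have "\<dots> = Suc t" using inv fin by (simp add: card_Diff_subset)
        finally show "of_nat (card (far ?A G k)) \<le> ennreal (real (Suc t))"
          unfolding ennreal_of_nat_eq_real_of_nat by (intro ennreal_leI of_nat_mono)
      qed
      also have "\<dots> = ennreal (real (Suc t))" by (simp add: measure_pmf.emeasure_space_1[simplified])
      also have "\<dots> \<le> ennreal (exp_tail (Suc k) (harm (Suc t)))"
        using exp_harm_ge[of "Suc t"] by (intro ennreal_leI) (simp add: 0 exp_tail_1[simplified])
      finally show ?thesis .
    next
      case (Suc j)
      let ?h = "1 / real (Suc t)"
      have harm_ge: "0 \<le> (harm t :: real)" by (rule harm_nonneg)
      have "(\<integral>\<^sup>+ G. of_nat (card (far ?A G (Suc j))) \<partial>copying_graph d p G0 (Suc t))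
          \<le> (\<integral>\<^sup>+ G. of_nat (card (far ?A G (Suc j))) + of_nat (card (far ?A G j)) * ennreal ?h
              \<partial>copying_graph d p G0 t)"
        unfolding copying_graph.simps nn_integral_bind_pmf
      proof (intro nn_integral_mono_AE AE_pmfI)
        fix G assume "G \<in> set_pmf (copying_graph d p G0 t)"
        note inv = copying_graph_invariant[OF assms(1) this]
        have "card ?A > 0" using ne fin by (simp add: card_gt_0_iff)
        \<comment> \<open>One initial vertex suffices for this bound. It replaces the random weight
          of a parent by \<open>1 / (t + 1)\<close>, which comes out of the expectation and is
          exactly the increment of the harmonic numbers.\<close>
        then have size: "Suc t \<le> card (verts G)" using inv by simp
        have "(\<integral>\<^sup>+ G'. of_nat (card (far ?A G' (Suc j))) \<partial>copying_step d p G)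
            \<le> of_nat (card (far ?A G (Suc j))) + of_nat (card (far ?A G j)) * ennreal (1 / real (card (verts G)))"
          using inv ne assms(2) by (intro nn_integral_far_copying_step) auto
        also have "\<dots> \<le> of_nat (card (far ?A G (Suc j))) + of_nat (card (far ?A G j)) * ennreal ?h"
          using size by (intro add_left_mono mult_left_mono ennreal_leI divide_left_mono) auto
        finally show "(\<integral>\<^sup>+ G'. of_nat (card (far ?A G' (Suc j))) \<partial>copying_step d p G)
            \<le> of_nat (card (far ?A G (Suc j))) + of_nat (card (far ?A G j)) * ennreal ?h" .
      qed
      also have "\<dots> = (\<integral>\<^sup>+ G. of_nat (card (far ?A G (Suc j))) \<partial>copying_graph d p G0 t)
          + (\<integral>\<^sup>+ G. of_nat (card (far ?A G j)) \<partial>copying_graph d p G0 t) * ennreal ?h"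
        by (simp add: nn_integral_add nn_integral_multc)
      also have "\<dots> \<le> ennreal (exp_tail (Suc (Suc j)) (harm t))
          + ennreal (exp_tail (Suc j) (harm t)) * ennreal ?h"
        by (intro add_mono mult_right_mono IH) auto
      also have "\<dots> = ennreal (exp_tail (Suc (Suc j)) (harm t) + ?h * exp_tail (Suc j) (harm t))"
        by (simp add: exp_tail_nonneg harm_ge mult.commute flip: ennreal_mult' ennreal_plus)
      also have "\<dots> \<le> ennreal (exp_tail (Suc (Suc j)) (harm t + ?h))"
        by (intro ennreal_leI exp_tail_add_ge harm_ge) simp
      also have "harm t + ?h = harm (Suc t)"
        by (simp add: harm_Suc inverse_eq_divide)
      finally show ?thesis by (simp add: Suc)
    qed
  qed
qed

section \<open>From the expectation to the diameter\<close>

lemma copying_graph_diameter_prob_ge: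
  assumes G0: "initial_graph d G0" and "d \<ge> 1" and "card (verts G0) \<le> l"
  shows "1 - exp_tail (Suc k) (harm t)
    \<le> measure_pmf.prob (copying_graph d p G0 t) {G. graph_diameter G \<le> ereal (real (4 * k + l))}"
proof -
  let ?M = "copying_graph d p G0 t" and ?A = "verts G0"
  let ?D = "{G. graph_diameter G \<le> ereal (real (4 * k + l))}"
  have tail_nonneg: "0 \<le> exp_tail (Suc k) (harm t)" by (intro exp_tail_nonneg harm_nonneg)
  have "emeasure ?M (- ?D) = (\<integral>\<^sup>+ G. indicator (- ?D) G \<partial>?M)" by simp
  also have "\<dots> \<le> (\<integral>\<^sup>+ G. of_nat (card (far ?A G k)) \<partial>?M)"
  proof (intro nn_integral_mono_AE AE_pmfI)
    fix G assume "G \<in> set_pmf ?M"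
    note inv = copying_graph_invariant[OF G0 this]
    interpret G: fin_digraph G using inv by (simp add: d_out_digraph_def)
    interpret I: fin_digraph G0 using G0 by (simp add: initial_graph_def d_out_digraph_def)
    have "graph_diameter G \<le> ereal (real (4 * k + l))" if "far ?A G k = {}"
    proof (rule G.graph_diameter_le[OF that])
      fix a b assume "a \<in> ?A" "b \<in> ?A"
      then have "(a, b) \<in> near G0 l"
        using G0 assms(3) by (intro I.near_if_connected) (auto simp: initial_graph_def)
      then show "(a, b) \<in> near G l" using near_mono inv by blast
    qed (use inv in blast)
    moreover have "finite (far ?A G k)"
      using far_subset_verts G.finite_verts by (rule finite_subset)
    \<comment> \<open>Markov's inequality at threshold 1: a large diameter forces a far vertex, and
      then the count is at least 1.\<close>
    ultimately have "indicator (- ?D) G \<le> card (far ?A G k)"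
      by (auto simp: indicator_def Suc_le_eq card_gt_0_iff)
    then have "of_nat (indicator (- ?D) G) \<le> (of_nat (card (far ?A G k)) :: ennreal)"
      by (rule of_nat_mono)
    then show "indicator (- ?D) G \<le> (of_nat (card (far ?A G k)) :: ennreal)"
      by (simp add: indicator_def split: if_splits)
  qed
  also have "\<dots> \<le> ennreal (exp_tail (Suc k) (harm t))"
    by (rule nn_integral_card_far_le[OF G0 \<open>d \<ge> 1\<close>])
  finally have "measure_pmf.prob ?M (- ?D) \<le> exp_tail (Suc k) (harm t)"
    using tail_nonneg by (simp add: measure_pmf.emeasure_eq_measure)
  moreover have "measure_pmf.prob ?M (- ?D) = 1 - measure_pmf.prob ?M ?D"
    using measure_pmf.prob_compl[of ?D ?M] by (simp add: Compl_eq_Diff_UNIV)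
  ultimately show ?thesis by simp
qed

theorem theorem2p3:
  fixes p :: real and d K :: nat and G0 :: "nat \<Rightarrow> ordered_digraph"
  assumes "0 \<le> p" and "p \<le> 1" and "d \<ge> 1"
    and "\<And>n. initial_graph d (G0 n)"
    and "\<And>n. card (verts (G0 n)) \<le> K"
  shows "\<exists>C :: real.
    (\<lambda>n. measure_pmf.prob (copying_graph d p (G0 n) n)
           {G. graph_diameter G \<le> ereal (4 * exp 1 * ln (real n) + C)}) \<longlonglongrightarrow> 1"
proof
  \<comment> \<open>This is what \<open>4 * k n + K\<close> leaves beside the logarithm:
    \<open>4 * exp 1\<close> from the 1 in the bound on the harmonic number, 4 from rounding up, and
    \<open>K\<close> for the initial graph.\<close>
  define C where "C = 4 * exp 1 + 4 + real K"
  \<comment> \<open>The least natural number that is guaranteed to be at least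
    \<open>exp 1 * harm n\<close> by the bound \<open>harm n \<le> 1 + ln n\<close>.\<close>
  define k where "k n = nat \<lceil>exp 1 * (1 + ln (real n))\<rceil>" for n
  define s where "s k = (real k / exp 1) ^ k / fact k" for k :: nat
  let ?prob = "\<lambda>n. measure_pmf.prob (copying_graph d p (G0 n) n)
    {G. graph_diameter G \<le> ereal (4 * exp 1 * ln (real n) + C)}"
  have lower: "1 - 2 * s (Suc (k n)) \<le> ?prob n" if n: "n \<ge> 1" for n
  proof -
    define x where "x = (harm n :: real)"
    define y where "y = exp 1 * (1 + ln (real n))"
    have "0 \<le> y" using n by (simp add: y_def)
    then have "y \<le> real (nat \<lceil>y\<rceil>)" "real (nat \<lceil>y\<rceil>) \<le> y + 1"
      by linarith+
    then have k_ge: "exp 1 * (1 + ln (real n)) \<le> real (k n)"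
      and k_le: "real (k n) \<le> exp 1 * (1 + ln (real n)) + 1"
      by (simp_all add: k_def y_def)
    have x: "0 \<le> x" "x \<le> 1 + ln (real n)"
      using harm_nonneg harm_le_ln n by (auto simp: x_def)
    have "exp 1 * x \<le> exp 1 * (1 + ln (real n))" using x by simp
    with k_ge have xk: "exp 1 * x \<le> real (k n)" by linarith
    \<comment> \<open>As \<open>exp 1\<close> is at least 2, the series is already past the point
      where its terms halve.\<close>
    have "2 * x \<le> exp 1 * x"
      using x exp_ge_add_one_self[of 1] by (intro mult_right_mono) auto
    with xk have "2 * x \<le> real (Suc (k n)) + 1" by simp
    then have "exp_tail (Suc (k n)) x \<le> 2 * (x ^ Suc (k n) / fact (Suc (k n)))"
      using x by (intro exp_tail_le)
    \<comment> \<open>Here \<open>x \<le> k n / exp 1 \<le> Suc (k n) / exp 1\<close>, which brings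
      in the Poisson term at its mean.\<close>
    also have "\<dots> \<le> 2 * s (Suc (k n))"
      unfolding s_def using x xk
      by (intro mult_left_mono divide_right_mono power_mono) (auto simp: field_simps)
    finally have "1 - 2 * s (Suc (k n)) \<le> 1 - exp_tail (Suc (k n)) x" by simp
    also have "\<dots> \<le> measure_pmf.prob (copying_graph d p (G0 n) n)
        {G. graph_diameter G \<le> ereal (real (4 * k n + K))}"
      unfolding x_def by (intro copying_graph_diameter_prob_ge assms)
    also have "\<dots> \<le> ?prob n"
    proof (intro measure_pmf.finite_measure_mono subsetI)
      fix G assume "G \<in> {G. graph_diameter G \<le> ereal (real (4 * k n + K))}"
      moreover have "real (4 * k n + K) \<le> 4 * exp 1 * ln (real n) + C"
        using k_le by (simp add: C_def algebra_simps)
      ultimately show "G \<in> {G. graph_diameter G \<le> ereal (4 * exp 1 * ln (real n) + C)}"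
        by (auto intro: order_trans)
    qed simp
    finally show ?thesis .
  qed
  have "filterlim k at_top sequentially"
    unfolding filterlim_sequentially_iff_filterlim_real
  proof (rule filterlim_at_top_mono)
    show "filterlim (\<lambda>n::nat. exp 1 * (1 + ln (real n)) :: real) at_top sequentially"
      by real_asymp
    show "eventually (\<lambda>n. exp 1 * (1 + ln (real n)) \<le> real (k n)) sequentially"
      unfolding k_def by (intro always_eventually allI real_nat_ceiling_ge)
  qed
  then have "filterlim (\<lambda>n. Suc (k n)) at_top sequentially"
    by (rule filterlim_compose[OF filterlim_Suc])
  with poisson_mode_tendsto_0 have "(\<lambda>n. s (Suc (k n))) \<longlonglongrightarrow> 0"
    unfolding s_def by (rule filterlim_compose)
  then have "(\<lambda>n. 1 - 2 * s (Suc (k n))) \<longlonglongrightarrow> 1 - 2 * 0"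
    by (intro tendsto_intros)
  then have lim: "(\<lambda>n. 1 - 2 * s (Suc (k n))) \<longlonglongrightarrow> 1" by simp
  show "?prob \<longlonglongrightarrow> 1"
  proof (rule tendsto_sandwich[OF _ _ lim tendsto_const])
    show "eventually (\<lambda>n. 1 - 2 * s (Suc (k n)) \<le> ?prob n) sequentially"
      using eventually_ge_at_top[of 1] by eventually_elim (rule lower)
  qed simp
qed

end
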